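(* Thomas, Janet and Pommaret divisions on the set $\mathbb{M}$ of monomials in $x_1,\dots,x_n$ are continuous. That is, for $L$ equal to any of these three divisions, for every finite set $U\subset\mathbb{M}$ and every finite sequence $u_1,\dots,u_k$ of elements of $U$ such that for every $i<k$ there is $x_j\in NM_L(u_i,U)$ with $u_{i+1}\,|_L\,(u_i\cdot x_j)$, one has $u_i\neq u_j$ whenever $i\neq j$.
   Context: $K$ is a field of characteristic zero, $\mathbb{M}$ is the monoid of monomials in $K[x_1,\dots,x_n]$, and $\deg_i(u)$ is the degree of $x_i$ in $u$. For each division $L$ below, each finite $U\subset\mathbb{M}$ and $u\in U$ determine the set $M_L(u,U)$ of multiplicative variables and the complementary set $NM_L(u,U)$ of non-multiplicative variables; $L(u,U)$ is the set of all monomials in the variables $M_L(u,U)$. For $u\in U$, $w\in\mathbb{M}$ one writes $u|_L w$ (w.r.t. $U$) if $w\in uL(u,U)$. Thomas division: for finite $U$ let $h_i(U)=\max\{\deg_i(u)\mid u\in U\}$. The variable $x_i$ is multiplicative for $u\in U$ if $\deg_i(u)=h_i(U)$ and non-multiplicative otherwise. Janet division: for finite $U$, $1\le i\le n$ and non-negative integers $d_1,\dots,d_i$ let $[d_1,\dots,d_i]=\{u\in U\mid \deg_j(u)=d_j,\ 1\le j\le i\}$. The variable $x_i$ is multiplicative for $u\in U$ if $i=1$ and $\deg_1(u)=\max\{\deg_1(v)\mid v\in U\}$, or if $i>1$, $u\in[d_1,\dots,d_{i-1}]$ and $\deg_i(u)=\max\{\deg_i(v)\mid v\in[d_1,\dots,d_{i-1}]\}$;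 otherwise it is non-multiplicative. Pommaret division: for a monomial $u=x_1^{d_1}\cdots x_k^{d_k}$ with $d_k>0$ the variables $x_j$ with $j\ge k$ are multiplicative and those with $j<k$ are non-multiplicative; for $u=1$ all variables are multiplicative (independently of $U$). *)

theory Defs
  imports Main "HOL-Library.Multiset"
begin

text \<open>
  A monomial in \<open>x\<^sub>1, \<dots>, x\<^sub>n\<close> is the multiset of the indices of its variables: \<open>x\<^sub>i\<close> is
  \<open>{#i#}\<close>, the product is \<open>+\<close> and the unit monomial is \<open>{#}\<close>. The coefficient field does not
  enter. Variables are identified with their indices in \<open>{1..n}\<close>.
\<close>

type_synonym monomial = "nat multiset"

definition monomials :: "nat \<Rightarrow> monomial set" where
  "monomials n = {u. set_mset u \<subseteq> {1..n}}"

abbreviation deg :: "nat \<Rightarrow> monomial \<Rightarrow> nat" where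
  "deg i u \<equiv> count u i"

text \<open>
  A division \<open>M\<close> on the monomials in \<open>x\<^sub>1, \<dots>, x\<^sub>n\<close> is given by its sets \<open>M u U\<close> of
  multiplicative variables; these are meaningful only for finite \<open>U\<close> and \<open>u \<in> U\<close>.
\<close>

type_synonym division = "monomial \<Rightarrow> monomial set \<Rightarrow> nat set"

definition nonmult_vars :: "nat \<Rightarrow> division \<Rightarrow> monomial \<Rightarrow> monomial set \<Rightarrow> nat set" where
  "nonmult_vars n M u U = {1..n} - M u U"

definition mult_monomials :: "division \<Rightarrow> monomial \<Rightarrow> monomial set \<Rightarrow> monomial set" where
  "mult_monomials M u U = {v. set_mset v \<subseteq> M u U}"

definition inv_divides :: "division \<Rightarrow> monomial set \<Rightarrow> monomial \<Rightarrow> monomial \<Rightarrow> bool" where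
  "inv_divides M U u w \<longleftrightarrow> w \<in> (\<lambda>v. u + v) ` mult_monomials M u U"

definition continuous_division :: "nat \<Rightarrow> division \<Rightarrow> bool" where
  "continuous_division n M \<longleftrightarrow>
    (\<forall>U us. finite U \<and> U \<subseteq> monomials n \<and> set us \<subseteq> U \<and>
       (\<forall>i. Suc i < length us \<longrightarrow>
          (\<exists>j \<in> nonmult_vars n M (us ! i) U. inv_divides M U (us ! Suc i) (us ! i + {#j#})))
     \<longrightarrow> (\<forall>i < length us. \<forall>j < length us. i \<noteq> j \<longrightarrow> us ! i \<noteq> us ! j))"

definition thomas :: "nat \<Rightarrow> division" where
  "thomas n u U = {i \<in> {1..n}. deg i u = Max (deg i ` U)}"

text \<open>The set \<open>[d\<^sub>1, \<dots>, d\<^sub>i]\<close>; only the values of \<open>d\<close> on \<open>{1..i}\<close> matter.\<close>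

definition janet_class :: "monomial set \<Rightarrow> nat \<Rightarrow> (nat \<Rightarrow> nat) \<Rightarrow> monomial set" where
  "janet_class U i d = {u \<in> U. \<forall>j \<in> {1..i}. deg j u = d j}"

definition janet :: "nat \<Rightarrow> division" where
  "janet n u U = {i \<in> {1..n}.
     (i = 1 \<and> deg 1 u = Max (deg 1 ` U)) \<or>
     (i > 1 \<and> (\<exists>d. u \<in> janet_class U (i - 1) d \<and>
                    deg i u = Max (deg i ` janet_class U (i - 1) d)))}"

text \<open>For \<open>u \<noteq> 1\<close> the index \<open>k\<close> with \<open>u = x\<^sub>1\<^bsup>d\<^sub>1\<^esup> \<cdots> x\<^sub>k\<^bsup>d\<^sub>k\<^esup>\<close>, \<open>d\<^sub>k > 0\<close>, is \<open>Max (set_mset u)\<close>.\<close>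

definition pommaret :: "nat \<Rightarrow> division" where
  "pommaret n u U = (if u = {#} then {1..n} else {j \<in> {1..n}. Max (set_mset u) \<le> j})"

end

theory Submission
  imports Defs "HOL-Library.Fun_Lexorder"
begin

text \<open>
  A step \<open>u \<mapsto> w\<close> of a sequence multiplies \<open>u\<close> by a non-multiplicative variable \<open>x\<^sub>j\<close> and passes to
  an involutive divisor \<open>w\<close> of the product, so \<open>u x\<^sub>j = w v\<close> with \<open>v\<close> in the multiplicative
  variables of \<open>w\<close>. A division is continuous as soon as every step goes up in some strict order,
  because the elements of a sequence are then pairwise distinct (\<open>continuous_division_if_increasing\<close>).
  Each of the three divisions has such an order.

  For Thomas division it is proper divisibility. If \<open>x\<^sub>i\<close> divides \<open>v\<close>, then \<open>w\<close> has the maximal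
  \<open>i\<close>-degree in \<open>U\<close> and \<open>u x\<^sub>j\<close> exceeds it. That is possible only when \<open>i = j\<close> and \<open>u\<close> itself has
  maximal \<open>j\<close>-degree, which makes \<open>x\<^sub>j\<close> multiplicative. So \<open>v = 1\<close> and \<open>w = u x\<^sub>j\<close>.

  For Janet division it is the lexicographic order with \<open>x\<^sub>1 > \<dots> > x\<^sub>n\<close>. If \<open>w\<close> were smaller than
  \<open>u\<close>, with \<open>i\<close> the first index at which they differ, then \<open>x\<^sub>i\<close> would divide \<open>v\<close>; but \<open>u\<close> and \<open>w\<close>
  lie in the same class \<open>[d\<^sub>1, \<dots>, d\<^bsub>i-1\<^esub>]\<close>, where \<open>w\<close> has to attain the maximal \<open>i\<close>-degree. And
  \<open>w = u\<close> would give \<open>v = x\<^sub>j\<close>, which is not multiplicative for \<open>u\<close>.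

  For Pommaret division the lexicographic order does not suffice: in \<open>U = {x\<^sub>1, x\<^sub>1 x\<^sub>2}\<close> there is a
  step from \<open>x\<^sub>1 x\<^sub>2\<close> down to \<open>x\<^sub>1\<close>. But the largest index of a variable never goes up along a step,
  and it stays the same only if \<open>w\<close> is lexicographically larger than \<open>u\<close>. So the order compares
  this index first, with the smaller index higher, and breaks ties lexicographically.
\<close>

lemma continuous_division_if_increasing:
  assumes trans: "transp R" and irrefl: "irreflp R"
    and step: "\<And>U u w j v. \<lbrakk>finite U; U \<subseteq> monomials n; u \<in> U; w \<in> U;
      j \<in> {1..n} - M u U; set_mset v \<subseteq> M w U; u + {#j#} = w + v\<rbrakk> \<Longrightarrow> R u w"
  shows "continuous_division n M"
  unfolding continuous_division_def
proof (intro allI impI, elim conjE)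
  fix U us i j
  assume U: "finite U" "U \<subseteq> monomials n" and us: "set us \<subseteq> U"
    and chain: "\<forall>i. Suc i < length us \<longrightarrow>
      (\<exists>j \<in> nonmult_vars n M (us ! i) U. inv_divides M U (us ! Suc i) (us ! i + {#j#}))"
    and ij: "i < length us" "j < length us" "i \<noteq> j"
  have "R (us ! i) (us ! Suc i)" if i: "Suc i < length us" for i
  proof -
    have "us ! i \<in> U" "us ! Suc i \<in> U"
      using us i by (auto simp: subset_iff)
    moreover obtain j v where "j \<in> {1..n} - M (us ! i) U" "set_mset v \<subseteq> M (us ! Suc i) U"
      "us ! i + {#j#} = us ! Suc i + v"
      using chain i unfolding nonmult_vars_def inv_divides_def mult_monomials_def by blast
    ultimately show ?thesis
      using step U by blast
  qed
  then have "sorted_wrt R us"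
    using trans by (simp add: sorted_wrt_iff_nth_Suc_transp)
  then show "us ! i \<noteq> us ! j"
    using ij irrefl by (metis irreflpD linorder_neqE_nat sorted_wrt_nth_less)
qed

lemma thomas_step_increases:
  assumes U: "finite U" "u \<in> U" "w \<in> U"
    and j: "j \<in> {1..n} - thomas n u U" and v: "set_mset v \<subseteq> thomas n w U"
    and eq: "u + {#j#} = w + v"
  shows "u \<subset># w"
proof -
  have "i \<notin># v" for i
  proof
    assume i: "i \<in># v"
    have "deg i u \<le> Max (deg i ` U)"
      using U by simp
    also have w: "Max (deg i ` U) = deg i w"
      using v i by (auto simp: thomas_def)
    finally have le: "deg i u \<le> deg i w" .
    have "deg i u + deg i {#j#} = deg i w + deg i v"
      using eq by (metis count_union)
    moreover obtain m where "deg i v = Suc m"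
      using i by (metis in_countE)
    ultimately have "i = j" "deg i u = deg i w"
      using le by (auto split: if_splits)
    then show False
      using w j by (auto simp: thomas_def)
  qed
  then have "v = {#}"
    by auto
  then show ?thesis
    using eq[symmetric] by simp
qed

theorem continuous_thomas: "continuous_division n (thomas n)"
  by (rule continuous_division_if_increasing[where R = "(\<subset>#)"])
    (auto intro: thomas_step_increases transpI irreflpI)

text \<open>
  The Janet condition on \<open>x\<^sub>i\<close> maximises \<open>deg\<^sub>i\<close> over the class of \<open>w\<close>, to which every \<open>u\<close> agreeing
  with \<open>w\<close> before \<open>i\<close> belongs.
\<close>

lemma janet_mult_var_maximal:
  assumes i: "i \<in> janet n w U" and U: "finite U" "u \<in> U"
    and same: "\<And>k. \<lbrakk>1 \<le> k; k < i\<rbrakk> \<Longrightarrow> deg k u = deg k w"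
  shows "deg i u \<le> deg i w"
proof (cases "i = 1")
  case True
  then show ?thesis
    using i U by (simp add: janet_def)
next
  case False
  then obtain d where d: "w \<in> janet_class U (i - 1) d"
    "deg i w = Max (deg i ` janet_class U (i - 1) d)"
    using i by (auto simp: janet_def)
  then have "u \<in> janet_class U (i - 1) d"
    using U same by (auto simp: janet_class_def)
  then show ?thesis
    using d U by (simp add: janet_class_def)
qed

lemma janet_step_increases:
  assumes U: "finite U" "u \<in> U"
    and j: "j \<in> {1..n} - janet n u U" and v: "set_mset v \<subseteq> janet n w U"
    and eq: "u + {#j#} = w + v"
  shows "less_fun (count u) (count w)"
proof -
  have "u \<noteq> w"
    using eq j v by auto
  then have "\<exists>i. deg i u \<noteq> deg i w"
    by (simp add: multiset_eq_iff)
  then obtain i where i: "deg i u \<noteq> deg i w" and same: "\<And>k. k < i \<Longrightarrow> deg k u = deg k w"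
    using exists_least_iff[of "\<lambda>i. deg i u \<noteq> deg i w"] by blast
  have "\<not> deg i w < deg i u"
  proof
    assume less: "deg i w < deg i u"
    have "deg i u + deg i {#j#} = deg i w + deg i v"
      using eq by (metis count_union)
    then have "i \<in># v"
      using less by (simp add: count_greater_zero_iff[symmetric] del: count_greater_zero_iff)
    then show False
      using janet_mult_var_maximal[of i n w U u] U v same less by fastforce
  qed
  then show ?thesis
    using i same by (intro less_funI exI[of _ i]) auto
qed

theorem continuous_janet: "continuous_division n (janet n)"
proof (rule continuous_division_if_increasing)
  show "transp (\<lambda>u w. less_fun (count u) (count w))"
    by (auto intro: transpI less_fun_trans)
  show "irreflp (\<lambda>u w. less_fun (count u) (count w))"
    by (auto intro: irreflpI simp: less_fun_irrefl)
qed (rule janet_step_increases)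

text \<open>The value \<open>0\<close> for the unit monomial lets one formula describe all multiplicative sets.\<close>

definition max_var :: "monomial \<Rightarrow> nat" where
  "max_var u = Max (insert 0 (set_mset u))"

lemma pommaret_conv_max_var: "pommaret n u U = {j \<in> {1..n}. max_var u \<le> j}"
  by (auto simp: pommaret_def max_var_def)

text \<open>
  A non-multiplicative \<open>x\<^sub>j\<close> lies below the largest index \<open>k\<close> of \<open>u\<close>, so \<open>u x\<^sub>j\<close> still has largest
  index \<open>k\<close>, and its divisor \<open>w\<close> has at most that. If \<open>w\<close> has largest index \<open>k\<close> as well, the cofactor
  \<open>v\<close> involves only variables from \<open>x\<^sub>k\<close> on. Hence \<open>w\<close> agrees with \<open>u x\<^sub>j\<close> below \<open>k\<close>, and \<open>j\<close> is the
  first index at which it differs from \<open>u\<close>.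
\<close>

lemma pommaret_step_increases:
  assumes j: "j \<in> {1..n} - pommaret n u U" and v: "set_mset v \<subseteq> pommaret n w U"
    and eq: "u + {#j#} = w + v"
  shows "max_var w < max_var u \<or> max_var w = max_var u \<and> less_fun (count u) (count w)"
proof -
  have ju: "j < max_var u"
    using j by (auto simp: pommaret_conv_max_var)
  have "max_var w \<le> max_var (w + v)"
    by (simp add: max_var_def Max_mono)
  also have "\<dots> = max j (max_var u)"
    by (simp add: eq[symmetric] max_var_def insert_commute[of 0 j])
  also have "\<dots> = max_var u"
    using ju by simp
  finally have "max_var w \<le> max_var u" .
  moreover have "less_fun (count u) (count w)" if same: "max_var w = max_var u"
  proof -
    have "deg i w = deg i u + deg i {#j#}" if "i < max_var u" for i
    proof -
      have "i \<notin># v"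
        using v same that by (auto simp: pommaret_conv_max_var)
      then show ?thesis
        using eq by (metis count_union not_in_iff add_0_right)
    qed
    then show ?thesis
      using ju by (intro less_funI exI[of _ j]) auto
  qed
  ultimately show ?thesis
    by linarith
qed

theorem continuous_pommaret: "continuous_division n (pommaret n)"
proof (rule continuous_division_if_increasing)
  let ?R = "\<lambda>u w. max_var w < max_var u \<or>
    max_var w = max_var u \<and> less_fun (count u) (count w)"
  show "transp ?R"
    by (auto intro: transpI less_fun_trans)
  show "irreflp ?R"
    by (auto intro: irreflpI simp: less_fun_irrefl)
qed (rule pommaret_step_increases)

theorem corollary4p11:
  fixes n :: nat
  shows "continuous_division n (thomas n) \<and> continuous_division n (janet n) \<and>
         continuous_division n (pommaret n)"
  using continuous_thomas continuous_janet continuous_pommaret by blast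

end
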